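(* The following three statements hold. (1) Let $\mathcal{C}$ be a locally finite extensive category. Then every object of $\mathcal{C}$ is a coproduct of a finite number of connected objects. (2) Let $\mathcal{C}$ be a category with finite coproducts such that every object of $\mathcal{C}$ is a finite coproduct of connected objects. Then $\mathcal{C}$ is an extensive category. (3) Let $\mathcal{C}$ be an extensive category. If an object $D$ of $\mathcal{C}$ decomposes into a finite coproduct of connected objects, then the decomposition is unique up to ordering and isomorphisms of each component; that is, if $D \cong \sum_{i=1}^{s} C_i \cong \sum_{i=1}^{t} D_i$ with all $C_i$ and all $D_i$ connected, then $s=t$ and, after reordering, $C_i\cong D_i$ for $i=1,\dots,s$.
   Context: A category is locally finite if the hom-set between any two objects is a finite set. The coproduct is written $A+B$ (or $\sum$), the initial object is $0$, and the canonical morphism $i_A:A\to A+B$ is called a coprojection. A finite coproduct may be empty, in which case it is the initial object $0$. In a category with finite coproducts, an object $C$ is connected if for all objects $A,B$ the natural map $\operatorname{Hom}(C,A)\coprod\operatorname{Hom}(C,B)\to\operatorname{Hom}(C,A+B)$ (composition with the coprojections) is bijective. A category is extensive if it has finite coproducts and: (i) for any morphism $f:A\to X_1+X_2$, the pullback of $f$ along the coprojection $i_{X_1}:X_1\to X_1+X_2$ exists; (ii) for any commutative diagram consisting of a row $A_1\to A\leftarrow A_2$, the row $X_1\xrightarrow{i_{X_1}}X_1+X_2\xleftarrow{i_{X_2}}X_2$, and vertical morphisms $A_1\to X_1$, $f:A\to X_1+X_2$, $A_2\to X_2$, the row $A_1\to A\leftarrow A_2$ is a coproduct diagram if and only if both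 squares are pullbacks. *)

theory Defs
  imports Main
begin

record ('o, 'm) category =
  Ob :: "'o set"
  Mor :: "'m set"
  Dom :: "'m \<Rightarrow> 'o"
  Cod :: "'m \<Rightarrow> 'o"
  Id :: "'o \<Rightarrow> 'm"
  Comp :: "'m \<Rightarrow> 'm \<Rightarrow> 'm"  (infixr "\<cdot>\<index>" 70)

definition Hom :: "('o, 'm, 'e) category_scheme \<Rightarrow> 'o \<Rightarrow> 'o \<Rightarrow> 'm set" where
  "Hom C A B = {f \<in> Mor C. Dom C f = A \<and> Cod C f = B}"

text \<open>Composition is written in the usual order: \<open>g \<cdot> f\<close> is ``first f, then g''.\<close>

locale category =
  fixes C (structure)
  assumes Dom_in_Ob: "f \<in> Mor C \<Longrightarrow> Dom C f \<in> Ob C"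
    and Cod_in_Ob: "f \<in> Mor C \<Longrightarrow> Cod C f \<in> Ob C"
    and Id_in_Hom: "A \<in> Ob C \<Longrightarrow> Id C A \<in> Hom C A A"
    and Comp_in_Hom: "\<lbrakk>f \<in> Hom C A B; g \<in> Hom C B D\<rbrakk> \<Longrightarrow> g \<cdot> f \<in> Hom C A D"
    and Comp_Id: "f \<in> Hom C A B \<Longrightarrow> f \<cdot> Id C A = f"
    and Id_Comp: "f \<in> Hom C A B \<Longrightarrow> Id C B \<cdot> f = f"
    and Comp_assoc:
      "\<lbrakk>f \<in> Hom C A B; g \<in> Hom C B D; h \<in> Hom C D E\<rbrakk> \<Longrightarrow> (h \<cdot> g) \<cdot> f = h \<cdot> (g \<cdot> f)"

definition locally_finite :: "('o, 'm, 'e) category_scheme \<Rightarrow> bool" where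
  "locally_finite C \<longleftrightarrow> (\<forall>A\<in>Ob C. \<forall>B\<in>Ob C. finite (Hom C A B))"

definition isomorphic :: "('o, 'm, 'e) category_scheme \<Rightarrow> 'o \<Rightarrow> 'o \<Rightarrow> bool" where
  "isomorphic C A B \<longleftrightarrow>
     A \<in> Ob C \<and> B \<in> Ob C \<and>
     (\<exists>f\<in>Hom C A B. \<exists>g\<in>Hom C B A. g \<cdot>\<^bsub>C\<^esub> f = Id C A \<and> f \<cdot>\<^bsub>C\<^esub> g = Id C B)"

text \<open>\<open>is_coproduct C I X p S\<close>: the object \<open>S\<close> with the coprojections \<open>p i : X i \<rightarrow> S\<close> is a
  coproduct of the family \<open>X i\<close>, \<open>i \<in> I\<close>.  For \<open>I = {}\<close> this says that \<open>S\<close> is initial.\<close>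

definition is_coproduct ::
  "('o, 'm, 'e) category_scheme \<Rightarrow> 'i set \<Rightarrow> ('i \<Rightarrow> 'o) \<Rightarrow> ('i \<Rightarrow> 'm) \<Rightarrow> 'o \<Rightarrow> bool" where
  "is_coproduct C I X p S \<longleftrightarrow>
     S \<in> Ob C \<and> (\<forall>i\<in>I. X i \<in> Ob C \<and> p i \<in> Hom C (X i) S) \<and>
     (\<forall>T\<in>Ob C. \<forall>f. (\<forall>i\<in>I. f i \<in> Hom C (X i) T) \<longrightarrow>
        (\<exists>!h. h \<in> Hom C S T \<and> (\<forall>i\<in>I. h \<cdot>\<^bsub>C\<^esub> p i = f i)))"

definition has_finite_coproducts :: "('o, 'm, 'e) category_scheme \<Rightarrow> bool" where
  "has_finite_coproducts C \<longleftrightarrow>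
     (\<forall>(n::nat) X. (\<forall>i<n. X i \<in> Ob C) \<longrightarrow> (\<exists>p S. is_coproduct C {..<n} X p S))"

text \<open>\<open>is_binary_coproduct C A B S i j\<close>: the row \<open>A \<rightarrow> S \<leftarrow> B\<close> with morphisms \<open>i\<close> and \<open>j\<close> is a
  coproduct diagram.  No coproducts are chosen: below, ``\<open>A + B\<close>'' is rendered by quantifying
  over all coproduct diagrams, which is harmless because they are unique up to isomorphism.\<close>

definition is_binary_coproduct ::
  "('o, 'm, 'e) category_scheme \<Rightarrow> 'o \<Rightarrow> 'o \<Rightarrow> 'o \<Rightarrow> 'm \<Rightarrow> 'm \<Rightarrow> bool" where
  "is_binary_coproduct C A B S i j \<longleftrightarrow>
     A \<in> Ob C \<and> B \<in> Ob C \<and> S \<in> Ob C \<and> i \<in> Hom C A S \<and> j \<in> Hom C B S \<and>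
     (\<forall>T\<in>Ob C. \<forall>f\<in>Hom C A T. \<forall>g\<in>Hom C B T.
        \<exists>!h. h \<in> Hom C S T \<and> h \<cdot>\<^bsub>C\<^esub> i = f \<and> h \<cdot>\<^bsub>C\<^esub> j = g)"

definition connected_object :: "('o, 'm, 'e) category_scheme \<Rightarrow> 'o \<Rightarrow> bool" where
  "connected_object C Z \<longleftrightarrow> Z \<in> Ob C \<and>
     (\<forall>A B S i j. is_binary_coproduct C A B S i j \<longrightarrow>
        bij_betw (case_sum (\<lambda>f. i \<cdot>\<^bsub>C\<^esub> f) (\<lambda>g. j \<cdot>\<^bsub>C\<^esub> g))
          (Hom C Z A <+> Hom C Z B) (Hom C Z S))"

text \<open>\<open>is_pullback C f g P p q\<close>: for \<open>f : A \<rightarrow> S\<close> and \<open>g : X \<rightarrow> S\<close>, the square with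
  \<open>p : P \<rightarrow> A\<close> and \<open>q : P \<rightarrow> X\<close> is a pullback.\<close>

definition is_pullback ::
  "('o, 'm, 'e) category_scheme \<Rightarrow> 'm \<Rightarrow> 'm \<Rightarrow> 'o \<Rightarrow> 'm \<Rightarrow> 'm \<Rightarrow> bool" where
  "is_pullback C f g P p q \<longleftrightarrow>
     f \<in> Mor C \<and> g \<in> Mor C \<and> Cod C f = Cod C g \<and> P \<in> Ob C \<and>
     p \<in> Hom C P (Dom C f) \<and> q \<in> Hom C P (Dom C g) \<and> f \<cdot>\<^bsub>C\<^esub> p = g \<cdot>\<^bsub>C\<^esub> q \<and>
     (\<forall>T\<in>Ob C. \<forall>u\<in>Hom C T (Dom C f). \<forall>v\<in>Hom C T (Dom C g).
        f \<cdot>\<^bsub>C\<^esub> u = g \<cdot>\<^bsub>C\<^esub> v \<longrightarrow>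
        (\<exists>!h. h \<in> Hom C T P \<and> p \<cdot>\<^bsub>C\<^esub> h = u \<and> q \<cdot>\<^bsub>C\<^esub> h = v))"

definition extensive :: "('o, 'm, 'e) category_scheme \<Rightarrow> bool" where
  "extensive C \<longleftrightarrow>
     has_finite_coproducts C \<and>
     (\<forall>X1 X2 S i1 i2 A f.
        is_binary_coproduct C X1 X2 S i1 i2 \<and> A \<in> Ob C \<and> f \<in> Hom C A S \<longrightarrow>
        (\<exists>P p q. is_pullback C f i1 P p q)) \<and>
     (\<forall>X1 X2 S i1 i2 A f A1 A2 a1 a2 h1 h2.
        is_binary_coproduct C X1 X2 S i1 i2 \<and>
        A \<in> Ob C \<and> A1 \<in> Ob C \<and> A2 \<in> Ob C \<and>
        f \<in> Hom C A S \<and> a1 \<in> Hom C A1 A \<and> a2 \<in> Hom C A2 A \<and>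
        h1 \<in> Hom C A1 X1 \<and> h2 \<in> Hom C A2 X2 \<and>
        f \<cdot>\<^bsub>C\<^esub> a1 = i1 \<cdot>\<^bsub>C\<^esub> h1 \<and> f \<cdot>\<^bsub>C\<^esub> a2 = i2 \<cdot>\<^bsub>C\<^esub> h2 \<longrightarrow>
        (is_binary_coproduct C A1 A2 A a1 a2 \<longleftrightarrow>
           is_pullback C f i1 A1 a1 h1 \<and> is_pullback C f i2 A2 a2 h2))"

definition is_finite_coproduct_of_connected ::
  "('o, 'm, 'e) category_scheme \<Rightarrow> 'o \<Rightarrow> bool" where
  "is_finite_coproduct_of_connected C A \<longleftrightarrow>
     (\<exists>(n::nat) X p. (\<forall>i<n. connected_object C (X i)) \<and> is_coproduct C {..<n} X p A)"

end

theory Submission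
  imports Defs
begin

text \<open>(1) In an extensive category coprojections are monic and disjoint and the initial object is
  strict, so a non-initial object that admits no decomposition into two non-initial summands is
  connected. Splitting terminates in the locally finite case because \<open>card (Hom A Q)\<close>, for
  \<open>Q = A + A\<close>, is multiplicative over coproducts and each non-initial summand of \<open>A\<close> has at least
  two morphisms to \<open>Q\<close>.

  (2) A morphism from a sum of connected objects to \<open>X1 + X2\<close> sends each component into exactly
  one of \<open>X1\<close> and \<open>X2\<close>. Sorting the components accordingly splits the domain, and testing on
  connected objects shows that the resulting squares are pullbacks.

  (3) Each component of one decomposition factors through a unique component of the other. The two
  assignments obtained in this way are mutually inverse, and so are the factoring morphisms; only
  the finite coproducts of the category are used.\<close>

context category
begin

lemma Hom_objects:
  assumes "f \<in> Hom C A B"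
  shows "A \<in> Ob C" and "B \<in> Ob C"
  using assms Dom_in_Ob Cod_in_Ob by (auto simp: Hom_def)

text \<open>Stated as a universal property of its own, so that no dummy family or index type is
  carried along; \<open>coproduct_empty_iff\<close> links it to empty coproducts.\<close>

definition initial_object where
  "initial_object Z \<longleftrightarrow> Z \<in> Ob C \<and> (\<forall>T\<in>Ob C. \<exists>!h. h \<in> Hom C Z T)"


section \<open>Coproducts\<close>

lemma binary_coproductD:
  assumes "is_binary_coproduct C A B S i j"
  shows "A \<in> Ob C" and "B \<in> Ob C" and "S \<in> Ob C" and "i \<in> Hom C A S" and "j \<in> Hom C B S"
  using assms by (simp_all add: is_binary_coproduct_def)

lemma binary_coproduct_desc:
  assumes "is_binary_coproduct C A B S i j" and "f \<in> Hom C A T" and "g \<in> Hom C B T"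
  shows "\<exists>h\<in>Hom C S T. h \<cdot> i = f \<and> h \<cdot> j = g"
  using assms Hom_objects(2)[OF assms(2)] unfolding is_binary_coproduct_def by blast

lemma binary_coproduct_ext:
  assumes "is_binary_coproduct C A B S i j" and "h \<in> Hom C S T" and "k \<in> Hom C S T"
    and "h \<cdot> i = k \<cdot> i" and "h \<cdot> j = k \<cdot> j"
  shows "h = k"
proof -
  have "T \<in> Ob C" "k \<cdot> i \<in> Hom C A T" "k \<cdot> j \<in> Hom C B T"
    using assms(3) Hom_objects binary_coproductD[OF assms(1)] Comp_in_Hom by blast+
  with assms show ?thesis unfolding is_binary_coproduct_def by blast
qed

lemma binary_coproductI:
  assumes "i \<in> Hom C A S" and "j \<in> Hom C B S"
    and "\<And>T f g. f \<in> Hom C A T \<Longrightarrow> g \<in> Hom C B T \<Longrightarrow> \<exists>h\<in>Hom C S T. h \<cdot> i = f \<and> h \<cdot> j = g"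
    and "\<And>T h k. h \<in> Hom C S T \<Longrightarrow> k \<in> Hom C S T \<Longrightarrow> h \<cdot> i = k \<cdot> i \<Longrightarrow> h \<cdot> j = k \<cdot> j \<Longrightarrow> h = k"
  shows "is_binary_coproduct C A B S i j"
  unfolding is_binary_coproduct_def
proof (intro conjI ballI)
  fix T f g assume "T \<in> Ob C" "f \<in> Hom C A T" "g \<in> Hom C B T"
  with assms(3) obtain h where "h \<in> Hom C S T" "h \<cdot> i = f" "h \<cdot> j = g" by blast
  then show "\<exists>!h. h \<in> Hom C S T \<and> h \<cdot> i = f \<and> h \<cdot> j = g"
    using assms(4) by (intro ex1I[of _ h]) auto
qed (use assms(1,2) Hom_objects in blast)+

lemma binary_coproduct_sym:
  assumes "is_binary_coproduct C A B S i j"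
  shows "is_binary_coproduct C B A S j i"
proof (rule binary_coproductI)
  show "\<exists>h\<in>Hom C S T. h \<cdot> j = f \<and> h \<cdot> i = g" if "f \<in> Hom C B T" "g \<in> Hom C A T" for T f g
    using binary_coproduct_desc[OF assms that(2,1)] by blast
  show "h = k" if "h \<in> Hom C S T" "k \<in> Hom C S T" "h \<cdot> j = k \<cdot> j" "h \<cdot> i = k \<cdot> i" for T h k
    using binary_coproduct_ext[OF assms] that by blast
qed (fact binary_coproductD[OF assms])+

text \<open>A morphism out of \<open>Z\<close> is forced, so a cocone amounts to its component on
  \<open>A\<close>. With \<open>A = Z\<close> this gives 0 = 0 + 0 with identity
  coprojections.\<close>

lemma binary_coproduct_initial:
  assumes "A \<in> Ob C" and "initial_object Z" and "z \<in> Hom C Z A"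
  shows "is_binary_coproduct C A Z A (Id C A) z"
proof (rule binary_coproductI)
  show "\<exists>h\<in>Hom C A T. h \<cdot> Id C A = f \<and> h \<cdot> z = g" if "f \<in> Hom C A T" "g \<in> Hom C Z T" for T f g
  proof -
    have "f \<cdot> z = g"
      using assms that Comp_in_Hom[OF assms(3) that(1)] Hom_objects(2)[OF that(1)]
      unfolding initial_object_def by blast
    with that Comp_Id show ?thesis by blast
  qed
  show "h = k" if "h \<in> Hom C A T" "k \<in> Hom C A T" "h \<cdot> Id C A = k \<cdot> Id C A" for T h k
    using that Comp_Id by metis
qed (use assms Id_in_Hom in blast)+

text \<open>Cocones on \<open>A'\<close> and \<open>B'\<close> correspond to cocones on
  \<open>A\<close> and \<open>B\<close> by composing with the inverses. This later turns a known
  splitting into the one given by prescribed pullbacks.\<close>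

lemma binary_coproduct_iso:
  assumes S: "is_binary_coproduct C A B S i j"
    and "u \<in> Hom C A' A" and "u' \<in> Hom C A A'" and "u \<cdot> u' = Id C A" and "u' \<cdot> u = Id C A'"
    and "v \<in> Hom C B' B" and "v' \<in> Hom C B B'" and "v \<cdot> v' = Id C B" and "v' \<cdot> v = Id C B'"
  shows "is_binary_coproduct C A' B' S (i \<cdot> u) (j \<cdot> v)"
proof (rule binary_coproductI)
  note [simp] = binary_coproductD[OF S]
  show "i \<cdot> u \<in> Hom C A' S" "j \<cdot> v \<in> Hom C B' S"
    using assms Comp_in_Hom binary_coproductD[OF S] by blast+
  show "\<exists>h\<in>Hom C S T. h \<cdot> (i \<cdot> u) = f \<and> h \<cdot> (j \<cdot> v) = g"
    if fg: "f \<in> Hom C A' T" "g \<in> Hom C B' T" for T f g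
  proof -
    have "f \<cdot> u' \<in> Hom C A T" "g \<cdot> v' \<in> Hom C B T"
      using fg assms Comp_in_Hom by blast+
    from binary_coproduct_desc[OF S this] obtain h
      where h: "h \<in> Hom C S T" "h \<cdot> i = f \<cdot> u'" "h \<cdot> j = g \<cdot> v'" by blast
    have "h \<cdot> (i \<cdot> u) = (h \<cdot> i) \<cdot> u" using Comp_assoc[OF assms(2) _ h(1)] by simp
    also have "\<dots> = f" using Comp_assoc[OF assms(2,3) fg(1)] Comp_Id[OF fg(1)] h assms by simp
    finally have 1: "h \<cdot> (i \<cdot> u) = f" .
    have "h \<cdot> (j \<cdot> v) = (h \<cdot> j) \<cdot> v" using Comp_assoc[OF assms(6) _ h(1)] by simp
    also have "\<dots> = g" using Comp_assoc[OF assms(6,7) fg(2)] Comp_Id[OF fg(2)] h assms by simp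
    finally show ?thesis using 1 h by blast
  qed
  show "h = k" if hk: "h \<in> Hom C S T" "k \<in> Hom C S T" "h \<cdot> (i \<cdot> u) = k \<cdot> (i \<cdot> u)"
    "h \<cdot> (j \<cdot> v) = k \<cdot> (j \<cdot> v)" for T h k
  proof (rule binary_coproduct_ext[OF S hk(1,2)])
    \<comment> \<open>Composing with \<open>u'\<close> undoes \<open>u\<close>, so agreement on
      \<open>i \<cdot> u\<close> forces agreement on \<open>i\<close>.\<close>
    have A: "h \<cdot> i = (h \<cdot> (i \<cdot> u)) \<cdot> u'" if "h \<in> Hom C S T" for h
    proof -
      have "(h \<cdot> (i \<cdot> u)) \<cdot> u' = ((h \<cdot> i) \<cdot> u) \<cdot> u'" using Comp_assoc[OF assms(2) _ that] by simp
      also have "\<dots> = h \<cdot> i"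
        using Comp_assoc[OF assms(3,2) Comp_in_Hom[OF _ that]] Comp_Id[OF Comp_in_Hom[OF _ that]] assms
        by simp
      finally show ?thesis ..
    qed
    show "h \<cdot> i = k \<cdot> i" using A[OF hk(1)] A[OF hk(2)] hk(3) by simp
    have B: "h \<cdot> j = (h \<cdot> (j \<cdot> v)) \<cdot> v'" if "h \<in> Hom C S T" for h
    proof -
      have "(h \<cdot> (j \<cdot> v)) \<cdot> v' = ((h \<cdot> j) \<cdot> v) \<cdot> v'" using Comp_assoc[OF assms(6) _ that] by simp
      also have "\<dots> = h \<cdot> j"
        using Comp_assoc[OF assms(7,6) Comp_in_Hom[OF _ that]] Comp_Id[OF Comp_in_Hom[OF _ that]] assms
        by simp
      finally show ?thesis ..
    qed
    show "h \<cdot> j = k \<cdot> j" using B[OF hk(1)] B[OF hk(2)] hk(4) by simp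
  qed
qed

section \<open>Coproducts of indexed families\<close>

lemma coproductD:
  assumes "is_coproduct C I X p S"
  shows "S \<in> Ob C" and "k \<in> I \<Longrightarrow> X k \<in> Ob C" and "k \<in> I \<Longrightarrow> p k \<in> Hom C (X k) S"
  using assms by (simp_all add: is_coproduct_def)

lemma coproduct_desc:
  assumes "is_coproduct C I X p S" and "T \<in> Ob C" and "\<And>k. k \<in> I \<Longrightarrow> f k \<in> Hom C (X k) T"
  shows "\<exists>h\<in>Hom C S T. \<forall>k\<in>I. h \<cdot> p k = f k"
proof -
  have "\<exists>!h. h \<in> Hom C S T \<and> (\<forall>i\<in>I. h \<cdot> p i = f i)"
    using assms unfolding is_coproduct_def by blast
  then show ?thesis by blast
qed

lemma coproduct_ext:
  assumes "is_coproduct C I X p S" and "h \<in> Hom C S T" and "h' \<in> Hom C S T"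
    and "\<And>k. k \<in> I \<Longrightarrow> h \<cdot> p k = h' \<cdot> p k"
  shows "h = h'"
proof -
  have "\<forall>i\<in>I. h' \<cdot> p i \<in> Hom C (X i) T"
    using coproductD(3)[OF assms(1)] Comp_in_Hom assms(3) by blast
  then have "\<exists>!g. g \<in> Hom C S T \<and> (\<forall>i\<in>I. g \<cdot> p i = h' \<cdot> p i)"
    using assms(1)[unfolded is_coproduct_def, THEN conjunct2, THEN conjunct2, rule_format,
        of T "\<lambda>i. h' \<cdot> p i"] Hom_objects(2)[OF assms(2)] by blast
  then show ?thesis using assms by blast
qed

lemma coproductI:
  assumes "S \<in> Ob C" and "\<And>k. k \<in> I \<Longrightarrow> p k \<in> Hom C (X k) S"
    and "\<And>T f. T \<in> Ob C \<Longrightarrow> (\<And>k. k \<in> I \<Longrightarrow> f k \<in> Hom C (X k) T)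
      \<Longrightarrow> \<exists>h\<in>Hom C S T. \<forall>k\<in>I. h \<cdot> p k = f k"
    and "\<And>T h h'. h \<in> Hom C S T \<Longrightarrow> h' \<in> Hom C S T \<Longrightarrow> (\<And>k. k \<in> I \<Longrightarrow> h \<cdot> p k = h' \<cdot> p k)
      \<Longrightarrow> h = h'"
  shows "is_coproduct C I X p S"
  unfolding is_coproduct_def
proof (intro conjI ballI allI impI)
  fix T f assume "T \<in> Ob C" "\<forall>i\<in>I. f i \<in> Hom C (X i) T"
  with assms(3)[of T f] obtain h where "h \<in> Hom C S T" "\<forall>k\<in>I. h \<cdot> p k = f k" by blast
  then show "\<exists>!h. h \<in> Hom C S T \<and> (\<forall>i\<in>I. h \<cdot> p i = f i)"
    using assms(4) by (intro ex1I[of _ h]) auto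
qed (use assms(1,2) Hom_objects in blast)+

lemma coproduct_empty_iff: "is_coproduct C {} X p S \<longleftrightarrow> initial_object S"
  by (auto simp: is_coproduct_def initial_object_def)

lemma coproduct_singleton:
  assumes "X k \<in> Ob C"
  shows "is_coproduct C {k} X (\<lambda>_. Id C (X k)) (X k)"
proof (rule coproductI)
  show "\<exists>h\<in>Hom C (X k) T. \<forall>l\<in>{k}. h \<cdot> Id C (X k) = f l"
    if "\<And>l. l \<in> {k} \<Longrightarrow> f l \<in> Hom C (X l) T" for T f
    using that[of k] Comp_Id by auto
  show "h = h'" if "h \<in> Hom C (X k) T" "h' \<in> Hom C (X k) T"
    "\<And>l. l \<in> {k} \<Longrightarrow> h \<cdot> Id C (X k) = h' \<cdot> Id C (X k)" for T h h'
    using that Comp_Id by (metis singletonI)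
qed (use assms Id_in_Hom in auto)

lemma coproduct_cong:
  assumes "\<And>k. k \<in> I \<Longrightarrow> X k = Y k" and "\<And>k. k \<in> I \<Longrightarrow> p k = q k"
  shows "is_coproduct C I X p S \<longleftrightarrow> is_coproduct C I Y q S"
  using assms by (simp add: is_coproduct_def)

lemma coproduct_reindex:
  assumes b: "bij_betw b I J" and S: "is_coproduct C J X p S"
  shows "is_coproduct C I (X \<circ> b) (p \<circ> b) S"
proof (rule coproductI)
  have bI: "b k \<in> J" if "k \<in> I" for k using b that by (auto simp: bij_betw_def)
  show "S \<in> Ob C" by (fact coproductD[OF S])
  show "(p \<circ> b) k \<in> Hom C ((X \<circ> b) k) S" if "k \<in> I" for k
    using coproductD(3)[OF S bI[OF that]] by simp
  show "\<exists>h\<in>Hom C S T. \<forall>k\<in>I. h \<cdot> (p \<circ> b) k = f k"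
    if T: "T \<in> Ob C" and f: "\<And>k. k \<in> I \<Longrightarrow> f k \<in> Hom C ((X \<circ> b) k) T" for T f
  proof -
    \<comment> \<open>The cocone on \<open>I\<close> is carried over to \<open>J\<close> along the
      inverse of \<open>b\<close>.\<close>
    have "f (inv_into I b l) \<in> Hom C (X l) T" if "l \<in> J" for l
      using f[of "inv_into I b l"] b that
      by (metis bij_betw_def bij_betw_inv_into_right comp_apply inv_into_into)
    from coproduct_desc[where f = "\<lambda>l. f (inv_into I b l)", OF S T this] obtain h
      where "h \<in> Hom C S T" "\<forall>l\<in>J. h \<cdot> p l = f (inv_into I b l)" by blast
    then show ?thesis using bI b by (auto simp: bij_betw_inv_into_left intro!: bexI[of _ h])
  qed
  show "h = h'" if h: "h \<in> Hom C S T" "h' \<in> Hom C S T"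
    "\<And>k. k \<in> I \<Longrightarrow> h \<cdot> (p \<circ> b) k = h' \<cdot> (p \<circ> b) k" for T h h'
  proof (rule coproduct_ext[OF S h(1,2)])
    fix l assume "l \<in> J"
    then obtain k where "k \<in> I" "l = b k" using b by (auto simp: bij_betw_def)
    then show "h \<cdot> p l = h' \<cdot> p l" using h(3) by simp
  qed
qed

text \<open>\<open>has_finite_coproducts\<close> speaks of the index sets \<open>{..<n}\<close>
  alone; an enumeration of \<open>I\<close> extends it to every finite index set, such as a subset
  of the components.\<close>

lemma finite_coproduct_exists:
  assumes "has_finite_coproducts C" and "finite I" and "\<And>k. k \<in> I \<Longrightarrow> X k \<in> Ob C"
  shows "\<exists>p S. is_coproduct C I X p S"
proof -
  obtain b where "bij_betw b {0..<card I} I" using ex_bij_betw_nat_finite[OF assms(2)] by blast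
  then have b: "bij_betw b {..<card I} I" by (simp add: atLeast0LessThan)
  then have "\<forall>i<card I. (X \<circ> b) i \<in> Ob C" using assms(3) by (auto simp: bij_betw_def)
  then obtain p S where "is_coproduct C {..<card I} (X \<circ> b) p S"
    using assms(1) unfolding has_finite_coproducts_def by blast
  from coproduct_reindex[OF bij_betw_inv_into[OF b] this]
  have "is_coproduct C I (X \<circ> b \<circ> inv_into {..<card I} b) (p \<circ> inv_into {..<card I} b) S" .
  \<comment> \<open>The reindexed family agrees with \<open>X\<close> on \<open>I\<close> but
    possibly not outside, hence the appeal to \<open>coproduct_cong\<close>.\<close>
  moreover have "(X \<circ> b \<circ> inv_into {..<card I} b) k = X k" if "k \<in> I" for k
    using bij_betw_inv_into_right[OF b that] by simp
  ultimately have "is_coproduct C I X (p \<circ> inv_into {..<card I} b) S"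
    using coproduct_cong by (metis (mono_tags, lifting))
  then show ?thesis by blast
qed

lemma binary_coproduct_exists:
  assumes "has_finite_coproducts C" and "A \<in> Ob C" and "B \<in> Ob C"
  shows "\<exists>S i j. is_binary_coproduct C A B S i j"
proof -
  have "(case b of True \<Rightarrow> A | False \<Rightarrow> B) \<in> Ob C" for b
    using assms(2,3) by (cases b) simp_all
  \<comment> \<open>The two Booleans serve as the index set of a binary coproduct.\<close>
  then obtain p S where S: "is_coproduct C UNIV (case_bool A B) p S"
    using finite_coproduct_exists[OF assms(1), of "UNIV :: bool set" "case_bool A B"] by auto
  have "is_binary_coproduct C A B S (p True) (p False)"
  proof (rule binary_coproductI)
    show "p True \<in> Hom C A S" "p False \<in> Hom C B S"
      using coproductD(3)[OF S, of True] coproductD(3)[OF S, of False] by simp_all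
    show "\<exists>h\<in>Hom C S T. h \<cdot> p True = f \<and> h \<cdot> p False = g"
      if "f \<in> Hom C A T" "g \<in> Hom C B T" for T f g
      using coproduct_desc[OF S Hom_objects(2)[OF that(1)], of "case_bool f g"] that
      by (auto simp: all_bool_eq split: bool.splits)
    show "h = k" if "h \<in> Hom C S T" "k \<in> Hom C S T" "h \<cdot> p True = k \<cdot> p True"
      "h \<cdot> p False = k \<cdot> p False" for T h k
      using coproduct_ext[OF S that(1,2)] that(3,4) by (metis (full_types))
  qed
  then show ?thesis by blast
qed

lemma initial_object_exists:
  assumes "has_finite_coproducts C"
  shows "\<exists>Z. initial_object Z"
  using finite_coproduct_exists[OF assms, of "{} :: nat set"] coproduct_empty_iff by blast

text \<open>Associativity of coproducts: the partial coproducts \<open>A\<close> and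
  \<open>B\<close> may be chosen freely, and the coprojections are induced by \<open>p\<close>. The
  equations with \<open>p k\<close> are recorded because later arguments trace single
  components.\<close>

lemma coproduct_split:
  assumes S: "is_coproduct C (I \<union> J) X p S" and IJ: "I \<inter> J = {}"
    and A: "is_coproduct C I X q A" and B: "is_coproduct C J X r B"
  shows "\<exists>i j. is_binary_coproduct C A B S i j \<and> (\<forall>k\<in>I. i \<cdot> q k = p k) \<and> (\<forall>k\<in>J. j \<cdot> r k = p k)"
proof -
  note pS = coproductD(3)[OF S]
  obtain i where i: "i \<in> Hom C A S" "\<forall>k\<in>I. i \<cdot> q k = p k"
    using coproduct_desc[OF A coproductD(1)[OF S], of p] pS by blast
  obtain j where j: "j \<in> Hom C B S" "\<forall>k\<in>J. j \<cdot> r k = p k"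
    using coproduct_desc[OF B coproductD(1)[OF S], of p] pS by blast
  have "is_binary_coproduct C A B S i j"
  proof (rule binary_coproductI[OF i(1) j(1)])
    show "\<exists>h\<in>Hom C S T. h \<cdot> i = f \<and> h \<cdot> j = g"
      if f: "f \<in> Hom C A T" and g: "g \<in> Hom C B T" for T f g
    proof -
      \<comment> \<open>The pair \<open>f\<close>, \<open>g\<close> read componentwise is a cocone
        on the whole family; disjointness puts the indices from \<open>J\<close> in the second
        branch.\<close>
      define e where "e k = (if k \<in> I then f \<cdot> q k else g \<cdot> r k)" for k
      have "e k \<in> Hom C (X k) T" if "k \<in> I \<union> J" for k
        using that Comp_in_Hom[OF coproductD(3)[OF A] f] Comp_in_Hom[OF coproductD(3)[OF B] g]
        by (auto simp: e_def)
      from coproduct_desc[OF S Hom_objects(2)[OF f] this] obtain h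
        where h: "h \<in> Hom C S T" "\<forall>k\<in>I \<union> J. h \<cdot> p k = e k" by blast
      have "h \<cdot> i = f"
      proof (rule coproduct_ext[OF A Comp_in_Hom[OF i(1) h(1)] f])
        fix k assume k: "k \<in> I"
        then show "(h \<cdot> i) \<cdot> q k = f \<cdot> q k"
          using Comp_assoc[OF coproductD(3)[OF A k] i(1) h(1)] i(2) h(2) by (simp add: e_def)
      qed
      moreover have "h \<cdot> j = g"
      proof (rule coproduct_ext[OF B Comp_in_Hom[OF j(1) h(1)] g])
        fix k assume k: "k \<in> J"
        then have "k \<notin> I" using IJ by blast
        with k show "(h \<cdot> j) \<cdot> r k = g \<cdot> r k"
          using Comp_assoc[OF coproductD(3)[OF B k] j(1) h(1)] j(2) h(2) by (simp add: e_def)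
      qed
      ultimately show ?thesis using h(1) by blast
    qed
    show "h = h'" if h: "h \<in> Hom C S T" "h' \<in> Hom C S T" "h \<cdot> i = h' \<cdot> i" "h \<cdot> j = h' \<cdot> j" for T h h'
    proof (rule coproduct_ext[OF S h(1,2)])
      fix k assume "k \<in> I \<union> J"
      then show "h \<cdot> p k = h' \<cdot> p k"
        using Comp_assoc[OF coproductD(3)[OF A] i(1)] Comp_assoc[OF coproductD(3)[OF B] j(1)] h i(2) j(2)
        by (metis Un_iff)
    qed
  qed
  with i j show ?thesis by blast
qed

text \<open>The reverse of \<open>coproduct_split\<close>, needed to concatenate the decompositions
  of two summands. A cocone is first induced on each part and then on \<open>S\<close>.\<close>

lemma coproduct_join:
  assumes A: "is_coproduct C I X q A" and B: "is_coproduct C J X r B" and IJ: "I \<inter> J = {}"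
    and S: "is_binary_coproduct C A B S i j"
  shows "is_coproduct C (I \<union> J) X (\<lambda>k. if k \<in> I then i \<cdot> q k else j \<cdot> r k) S"
    (is "is_coproduct C _ X ?p S")
proof (rule coproductI)
  note i = binary_coproductD(4)[OF S] and j = binary_coproductD(5)[OF S]
  show "S \<in> Ob C" by (fact binary_coproductD[OF S])
  show "?p k \<in> Hom C (X k) S" if "k \<in> I \<union> J" for k
    using that Comp_in_Hom[OF coproductD(3)[OF A] i] Comp_in_Hom[OF coproductD(3)[OF B] j] by auto
  show "\<exists>h\<in>Hom C S T. \<forall>k\<in>I \<union> J. h \<cdot> ?p k = f k"
    if T: "T \<in> Ob C" and f: "\<And>k. k \<in> I \<union> J \<Longrightarrow> f k \<in> Hom C (X k) T" for T f
  proof -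
    obtain a where a: "a \<in> Hom C A T" "\<forall>k\<in>I. a \<cdot> q k = f k"
      using coproduct_desc[OF A T, of f] f by blast
    obtain b where b: "b \<in> Hom C B T" "\<forall>k\<in>J. b \<cdot> r k = f k"
      using coproduct_desc[OF B T, of f] f by blast
    obtain h where h: "h \<in> Hom C S T" "h \<cdot> i = a" "h \<cdot> j = b"
      using binary_coproduct_desc[OF S a(1) b(1)] by blast
    have "h \<cdot> ?p k = f k" if "k \<in> I \<union> J" for k
      using Comp_assoc[OF coproductD(3)[OF A, of k] i h(1)] Comp_assoc[OF coproductD(3)[OF B, of k] j h(1)]
        a(2) b(2) h(2,3) that by auto
    with h(1) show ?thesis by blast
  qed
  show "h = h'" if h: "h \<in> Hom C S T" "h' \<in> Hom C S T"
    "\<And>k. k \<in> I \<union> J \<Longrightarrow> h \<cdot> ?p k = h' \<cdot> ?p k" for T h h'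
  proof (rule binary_coproduct_ext[OF S h(1,2)])
    show "h \<cdot> i = h' \<cdot> i"
    proof (rule coproduct_ext[OF A Comp_in_Hom[OF i h(1)] Comp_in_Hom[OF i h(2)]])
      fix k assume k: "k \<in> I"
      then show "(h \<cdot> i) \<cdot> q k = (h' \<cdot> i) \<cdot> q k"
        using Comp_assoc[OF coproductD(3)[OF A k] i] h(1,2) h(3)[of k] by simp
    qed
    show "h \<cdot> j = h' \<cdot> j"
    proof (rule coproduct_ext[OF B Comp_in_Hom[OF j h(1)] Comp_in_Hom[OF j h(2)]])
      fix k assume k: "k \<in> J"
      then have "k \<notin> I" using IJ by blast
      with k show "(h \<cdot> j) \<cdot> r k = (h' \<cdot> j) \<cdot> r k"
        using Comp_assoc[OF coproductD(3)[OF B k] j] h(1,2) h(3)[of k] by simp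
    qed
  qed
qed


section \<open>Connected objects\<close>

text \<open>These are the surjectivity of the bijection, its injectivity within the left summand,
  and its injectivity across the summands. The right summand is covered by
  \<open>binary_coproduct_sym\<close>.\<close>

lemma connectedD:
  assumes "connected_object C Z" and "is_binary_coproduct C A B S i j"
  shows "f \<in> Hom C Z S \<Longrightarrow> (\<exists>g\<in>Hom C Z A. i \<cdot> g = f) \<or> (\<exists>g\<in>Hom C Z B. j \<cdot> g = f)"
    and "g \<in> Hom C Z A \<Longrightarrow> g' \<in> Hom C Z A \<Longrightarrow> i \<cdot> g = i \<cdot> g' \<Longrightarrow> g = g'"
    and "g \<in> Hom C Z A \<Longrightarrow> h \<in> Hom C Z B \<Longrightarrow> i \<cdot> g \<noteq> j \<cdot> h"
proof -
  let ?F = "case_sum (\<lambda>f. i \<cdot> f) (\<lambda>g. j \<cdot> g)"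
  have b: "bij_betw ?F (Hom C Z A <+> Hom C Z B) (Hom C Z S)"
    using assms unfolding connected_object_def by blast
  then have inj: "inj_on ?F (Hom C Z A <+> Hom C Z B)"
    and surj: "?F ` (Hom C Z A <+> Hom C Z B) = Hom C Z S" by (simp_all add: bij_betw_def)
  show "(\<exists>g\<in>Hom C Z A. i \<cdot> g = f) \<or> (\<exists>g\<in>Hom C Z B. j \<cdot> g = f)" if "f \<in> Hom C Z S"
  proof -
    from that surj obtain x where "x \<in> Hom C Z A <+> Hom C Z B" "f = ?F x" by blast
    then show ?thesis by auto
  qed
  show "g = g'" if "g \<in> Hom C Z A" "g' \<in> Hom C Z A" "i \<cdot> g = i \<cdot> g'"
    using inj_onD[OF inj, of "Inl g" "Inl g'"] that by auto
  show "i \<cdot> g \<noteq> j \<cdot> h" if "g \<in> Hom C Z A" "h \<in> Hom C Z B"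
    using inj_onD[OF inj, of "Inl g" "Inr h"] that by auto
qed

lemma connected_Ob: "connected_object C Z \<Longrightarrow> Z \<in> Ob C"
  by (simp add: connected_object_def)

text \<open>Since 0 = 0 + 0 with identities as coprojections, a morphism into 0 would come from both
  summands at once. In particular a connected object is never initial.\<close>

lemma connected_Hom_initial:
  assumes "connected_object C Z" and "initial_object O'"
  shows "Hom C Z O' = {}"
proof -
  have "O' \<in> Ob C" using assms(2) by (simp add: initial_object_def)
  then have "is_binary_coproduct C O' O' O' (Id C O') (Id C O')"
    using binary_coproduct_initial assms(2) Id_in_Hom by blast
  from connectedD(3)[OF assms(1) this] show ?thesis by blast
qed

text \<open>Induction on the index set: one component is split off at a time, and connectedness
  decides between it and the coproduct of the rest. The empty case is the absence of morphisms to
  0.\<close>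

lemma connected_factor:
  assumes fc: "has_finite_coproducts C" and Z: "connected_object C Z"
    and "finite I" and "is_coproduct C I X p S" and "f \<in> Hom C Z S"
  shows "\<exists>k\<in>I. \<exists>g\<in>Hom C Z (X k). p k \<cdot> g = f"
  using assms(3-5)
proof (induction I arbitrary: p S f rule: finite_induct)
  case empty
  then show ?case using connected_Hom_initial[OF Z] coproduct_empty_iff by blast
next
  case (insert l F)
  have Xl: "X l \<in> Ob C" using coproductD(2)[OF insert.prems(1)] by blast
  obtain r B where B: "is_coproduct C F X r B"
    using finite_coproduct_exists[OF fc insert.hyps(1)] coproductD(2)[OF insert.prems(1)] by blast
  have S: "is_coproduct C ({l} \<union> F) X p S" and disj: "{l} \<inter> F = {}" using insert by auto
  obtain i j where bc: "is_binary_coproduct C (X l) B S i j"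
    and i: "i \<cdot> Id C (X l) = p l" and j: "\<forall>k\<in>F. j \<cdot> r k = p k"
    using coproduct_split[OF S disj coproduct_singleton[of X l, OF Xl] B] by auto
  note iH = binary_coproductD(4)[OF bc] and jH = binary_coproductD(5)[OF bc]
  from connectedD(1)[OF Z bc insert.prems(2)] show ?case
  proof
    assume "\<exists>g\<in>Hom C Z (X l). i \<cdot> g = f"
    then show ?thesis using i Comp_Id[OF iH] by auto
  next
    assume "\<exists>g\<in>Hom C Z B. j \<cdot> g = f"
    then obtain g where g: "g \<in> Hom C Z B" "j \<cdot> g = f" by blast
    from insert.IH[OF B g(1)] obtain k e where k: "k \<in> F" "e \<in> Hom C Z (X k)" "r k \<cdot> e = g" by blast
    then have "p k \<cdot> e = f"
      using Comp_assoc[OF k(2) coproductD(3)[OF B k(1)] jH] j g(2) by simp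
    with k show ?thesis by blast
  qed
qed

text \<open>No induction here: the component \<open>k\<close> is separated from all others, so a
  single binary coproduct decides the matter.\<close>

lemma connected_factor_unique:
  assumes fc: "has_finite_coproducts C" and Z: "connected_object C Z"
    and "finite I" and S: "is_coproduct C I X p S"
    and k: "k \<in> I" and l: "l \<in> I" and g: "g \<in> Hom C Z (X k)" and h: "h \<in> Hom C Z (X l)"
    and eq: "p k \<cdot> g = p l \<cdot> h"
  shows "k = l \<and> g = h"
proof -
  let ?J = "I - {k}"
  have Xk: "X k \<in> Ob C" using coproductD(2)[OF S k] .
  obtain r B where B: "is_coproduct C ?J X r B"
    using finite_coproduct_exists[OF fc, of ?J X] assms(3) coproductD(2)[OF S] by blast
  have "{k} \<union> ?J = I" using k by blast
  then have S': "is_coproduct C ({k} \<union> ?J) X p S" using S by simp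
  obtain i j where bc: "is_binary_coproduct C (X k) B S i j"
    and i: "i \<cdot> Id C (X k) = p k" and j: "\<forall>k\<in>?J. j \<cdot> r k = p k"
    using coproduct_split[OF S' _ coproduct_singleton[of X k, OF Xk] B] by auto
  have ip: "i = p k" using i Comp_Id[OF binary_coproductD(4)[OF bc]] by simp
  show ?thesis
  proof (cases "l = k")
    case True
    then show ?thesis using connectedD(2)[OF Z bc g] h eq ip by simp
  next
    case False
    with l have lJ: "l \<in> ?J" by blast
    note rl = coproductD(3)[OF B lJ]
    \<comment> \<open>For \<open>l\<close> different from \<open>k\<close> the second factorization
      passes through \<open>B\<close>, against the disjointness in
      \<open>connectedD\<close>.\<close>
    have "p l \<cdot> h = j \<cdot> (r l \<cdot> h)"
      using Comp_assoc[OF h rl binary_coproductD(5)[OF bc]] j lJ by simp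
    then show ?thesis using connectedD(3)[OF Z bc g Comp_in_Hom[OF h rl]] eq ip by simp
  qed
qed

section \<open>Uniqueness of decompositions\<close>

lemma isomorphic_sym: "isomorphic C A B \<Longrightarrow> isomorphic C B A"
  unfolding isomorphic_def by blast

lemma isomorphic_trans:
  assumes "isomorphic C A B" and "isomorphic C B D"
  shows "isomorphic C A D"
proof -
  obtain f f' where f: "f \<in> Hom C A B" "f' \<in> Hom C B A" "f' \<cdot> f = Id C A" "f \<cdot> f' = Id C B"
    using assms(1) unfolding isomorphic_def by blast
  obtain g g' where g: "g \<in> Hom C B D" "g' \<in> Hom C D B" "g' \<cdot> g = Id C B" "g \<cdot> g' = Id C D"
    using assms(2) unfolding isomorphic_def by blast
  have "(f' \<cdot> g') \<cdot> (g \<cdot> f) = f' \<cdot> (g' \<cdot> (g \<cdot> f))"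
    using Comp_assoc f g Comp_in_Hom by metis
  also have "\<dots> = Id C A" using Comp_assoc[OF f(1) g(1,2)] Id_Comp f g by simp
  finally have 1: "(f' \<cdot> g') \<cdot> (g \<cdot> f) = Id C A" .
  have "(g \<cdot> f) \<cdot> (f' \<cdot> g') = g \<cdot> (f \<cdot> (f' \<cdot> g'))"
    using Comp_assoc f g Comp_in_Hom by metis
  also have "\<dots> = Id C D" using Comp_assoc[OF g(2) f(2,1)] Id_Comp f g by simp
  finally have 2: "(g \<cdot> f) \<cdot> (f' \<cdot> g') = Id C D" .
  show ?thesis
    unfolding isomorphic_def using 1 2 Comp_in_Hom f g assms by (meson isomorphic_def)
qed

text \<open>Both \<open>p k \<cdot> Id C (X k)\<close> and \<open>p m \<cdot> (h \<cdot> g)\<close>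
  equal \<open>p k\<close>, and factorizations of a morphism from a connected object through
  components are unique. It is applied in both directions.\<close>

lemma connected_round_trip:
  assumes fc: "has_finite_coproducts C" and conn: "connected_object C (X k)"
    and I: "finite I" and S: "is_coproduct C I X p S" and T: "is_coproduct C J Y q T"
    and e: "e \<in> Hom C S T" "e' \<in> Hom C T S" "e' \<cdot> e = Id C S"
    and k: "k \<in> I" and l: "l \<in> J" and m: "m \<in> I"
    and g: "g \<in> Hom C (X k) (Y l)" "q l \<cdot> g = e \<cdot> p k"
    and h: "h \<in> Hom C (Y l) (X m)" "p m \<cdot> h = e' \<cdot> q l"
  shows "k = m \<and> h \<cdot> g = Id C (X k)"
proof -
  note pk = coproductD(3)[OF S k] and pm = coproductD(3)[OF S m] and ql = coproductD(3)[OF T l]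
  have "p k \<cdot> Id C (X k) = (e' \<cdot> e) \<cdot> p k" using Comp_Id[OF pk] Id_Comp[OF pk] e(3) by simp
  also have "\<dots> = e' \<cdot> (q l \<cdot> g)" using Comp_assoc[OF pk e(1,2)] g(2) by simp
  also have "\<dots> = (p m \<cdot> h) \<cdot> g" using Comp_assoc[OF g(1) ql e(2)] h(2) by simp
  also have "\<dots> = p m \<cdot> (h \<cdot> g)" using Comp_assoc[OF g(1) h(1) pm] .
  finally show ?thesis
    using connected_factor_unique[OF fc conn I S k m Id_in_Hom Comp_in_Hom[OF g(1) h(1)]]
      connected_Ob[OF conn] by auto
qed

theorem connected_decomposition_unique:
  assumes fc: "has_finite_coproducts C"
    and X: "\<And>i. i \<in> I \<Longrightarrow> connected_object C (X i)" and I: "finite I" and S: "is_coproduct C I X p S"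
    and Y: "\<And>j. j \<in> J \<Longrightarrow> connected_object C (Y j)" and J: "finite J" and T: "is_coproduct C J Y q T"
    and "isomorphic C S T"
  shows "\<exists>\<pi>. bij_betw \<pi> I J \<and> (\<forall>i\<in>I. isomorphic C (X i) (Y (\<pi> i)))"
proof -
  obtain e e' where e: "e \<in> Hom C S T" "e' \<in> Hom C T S" "e' \<cdot> e = Id C S" "e \<cdot> e' = Id C T"
    using assms(8) unfolding isomorphic_def by blast
  \<comment> \<open>\<open>\<pi> i\<close> is the component of \<open>T\<close> through which
    \<open>X i\<close> maps after \<open>e\<close>; \<open>\<sigma>\<close> below is obtained the
    same way from \<open>e'\<close>.\<close>
  have "\<forall>i\<in>I. \<exists>j g. j \<in> J \<and> g \<in> Hom C (X i) (Y j) \<and> q j \<cdot> g = e \<cdot> p i"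
    using connected_factor[OF fc X J T Comp_in_Hom[OF coproductD(3)[OF S] e(1)]] by blast
  then obtain \<pi> g where g: "\<And>i. i \<in> I \<Longrightarrow> \<pi> i \<in> J \<and> g i \<in> Hom C (X i) (Y (\<pi> i)) \<and> q (\<pi> i) \<cdot> g i = e \<cdot> p i"
    by metis
  have "\<forall>j\<in>J. \<exists>i h. i \<in> I \<and> h \<in> Hom C (Y j) (X i) \<and> p i \<cdot> h = e' \<cdot> q j"
    using connected_factor[OF fc Y I S Comp_in_Hom[OF coproductD(3)[OF T] e(2)]] by blast
  then obtain \<sigma> h where h: "\<And>j. j \<in> J \<Longrightarrow> \<sigma> j \<in> I \<and> h j \<in> Hom C (Y j) (X (\<sigma> j)) \<and> p (\<sigma> j) \<cdot> h j = e' \<cdot> q j"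
    by metis
  have \<sigma>\<pi>: "\<sigma> (\<pi> i) = i \<and> h (\<pi> i) \<cdot> g i = Id C (X i)" if "i \<in> I" for i
    using connected_round_trip[OF fc X I S T e(1-3), of i] that g h by metis
  have \<pi>\<sigma>: "\<pi> (\<sigma> j) = j \<and> g (\<sigma> j) \<cdot> h j = Id C (Y j)" if "j \<in> J" for j
    using connected_round_trip[OF fc Y J T S e(2,1,4), of j] that g h by metis
  have "bij_betw \<pi> I J"
    by (rule bij_betw_byWitness[where f' = \<sigma>]) (use \<sigma>\<pi> \<pi>\<sigma> g h in auto)
  moreover have "isomorphic C (X i) (Y (\<pi> i))" if i: "i \<in> I" for i
  proof -
    note gi = g[OF i]
    \<comment> \<open>The round trip starting at \<open>\<pi> i\<close> gives the other inverse law,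
      because \<open>\<sigma> (\<pi> i) = i\<close>.\<close>
    then have "h (\<pi> i) \<in> Hom C (Y (\<pi> i)) (X i)" "g i \<cdot> h (\<pi> i) = Id C (Y (\<pi> i))"
      using h[of "\<pi> i"] \<sigma>\<pi>[OF i] \<pi>\<sigma>[of "\<pi> i"] by auto
    then show ?thesis
      unfolding isomorphic_def using gi \<sigma>\<pi>[OF i] Hom_objects by blast
  qed
  ultimately show ?thesis by blast
qed


section \<open>Objects that decompose into connected objects\<close>

lemma pullbackD:
  assumes "is_pullback C f g P p q" and "f \<in> Hom C A S" and "g \<in> Hom C X S"
  shows "p \<in> Hom C P A" and "q \<in> Hom C P X" and "f \<cdot> p = g \<cdot> q"
    and "u \<in> Hom C T A \<Longrightarrow> v \<in> Hom C T X \<Longrightarrow> f \<cdot> u = g \<cdot> v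
      \<Longrightarrow> \<exists>!h. h \<in> Hom C T P \<and> p \<cdot> h = u \<and> q \<cdot> h = v"
proof -
  have *: "Dom C f = A" "Dom C g = X" using assms by (auto simp: Hom_def)
  then show "p \<in> Hom C P A" "q \<in> Hom C P X" "f \<cdot> p = g \<cdot> q"
    using assms(1) by (simp_all add: is_pullback_def)
  show "\<exists>!h. h \<in> Hom C T P \<and> p \<cdot> h = u \<and> q \<cdot> h = v"
    if "u \<in> Hom C T A" "v \<in> Hom C T X" "f \<cdot> u = g \<cdot> v"
    using assms(1) that Hom_objects(1)[OF that(1)] unfolding is_pullback_def * by blast
qed

lemma pullbackI:
  assumes "f \<in> Hom C A S" and "g \<in> Hom C X S"
    and "p \<in> Hom C P A" and "q \<in> Hom C P X" and "f \<cdot> p = g \<cdot> q"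
    and "\<And>T u v. u \<in> Hom C T A \<Longrightarrow> v \<in> Hom C T X \<Longrightarrow> f \<cdot> u = g \<cdot> v
      \<Longrightarrow> \<exists>!h. h \<in> Hom C T P \<and> p \<cdot> h = u \<and> q \<cdot> h = v"
  shows "is_pullback C f g P p q"
proof -
  have *: "Dom C f = A" "Dom C g = X" "Cod C f = S" "Cod C g = S" "f \<in> Mor C" "g \<in> Mor C"
    using assms(1,2) by (auto simp: Hom_def)
  show ?thesis
    unfolding is_pullback_def * using assms * Hom_objects(1)[OF assms(3)] by blast
qed

text \<open>The usual comparison of universal objects. The equation \<open>p' \<cdot> u = p\<close>
  is kept because it identifies one leg with the other when a coproduct diagram is
  transported.\<close>

lemma pullback_unique:
  assumes P: "is_pullback C f g P p q" and P': "is_pullback C f g P' p' q'"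
    and f: "f \<in> Hom C A S" and g: "g \<in> Hom C X S"
  shows "\<exists>u\<in>Hom C P P'. \<exists>u'\<in>Hom C P' P. u \<cdot> u' = Id C P' \<and> u' \<cdot> u = Id C P \<and> p' \<cdot> u = p"
proof -
  note D = pullbackD[OF P f g] and D' = pullbackD[OF P' f g]
  obtain u where u: "u \<in> Hom C P P'" "p' \<cdot> u = p" "q' \<cdot> u = q" using D'(4)[OF D(1-3)] by blast
  obtain u' where u': "u' \<in> Hom C P' P" "p \<cdot> u' = p'" "q \<cdot> u' = q'" using D(4)[OF D'(1-3)] by blast
  have "p \<cdot> (u' \<cdot> u) = p" "q \<cdot> (u' \<cdot> u) = q"
    using Comp_assoc[OF u(1) u'(1) D(1)] Comp_assoc[OF u(1) u'(1) D(2)] u u' by simp_all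
  moreover have "p \<cdot> Id C P = p" "q \<cdot> Id C P = q" using Comp_Id D by blast+
  ultimately have 1: "u' \<cdot> u = Id C P"
    using D(4)[OF D(1-3)] Comp_in_Hom[OF u(1) u'(1)] Id_in_Hom[OF Hom_objects(1)[OF D(1)]] by blast
  have "p' \<cdot> (u \<cdot> u') = p'" "q' \<cdot> (u \<cdot> u') = q'"
    using Comp_assoc[OF u'(1) u(1) D'(1)] Comp_assoc[OF u'(1) u(1) D'(2)] u u' by simp_all
  moreover have "p' \<cdot> Id C P' = p'" "q' \<cdot> Id C P' = q'" using Comp_Id D' by blast+
  ultimately have "u \<cdot> u' = Id C P'"
    using D'(4)[OF D'(1-3)] Comp_in_Hom[OF u'(1) u(1)] Id_in_Hom[OF Hom_objects(1)[OF D'(1)]] by blast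
  with 1 u u' show ?thesis by blast
qed

text \<open>Equality of morphisms out of \<open>T\<close> can be tested on its connected components,
  where composition with \<open>i\<close> is injective.\<close>

lemma coprojection_monic_of_decomposition:
  assumes T: "is_finite_coproduct_of_connected C T" and S: "is_binary_coproduct C A B S i j"
    and u: "u \<in> Hom C T A" and v: "v \<in> Hom C T A" and eq: "i \<cdot> u = i \<cdot> v"
  shows "u = v"
proof -
  obtain n X p where X: "\<forall>k<(n::nat). connected_object C (X k)" and p: "is_coproduct C {..<n} X p T"
    using T unfolding is_finite_coproduct_of_connected_def by blast
  note i = binary_coproductD(4)[OF S]
  show ?thesis
  proof (rule coproduct_ext[OF p u v])
    fix k assume k: "k \<in> {..<n}"
    note pk = coproductD(3)[OF p k]
    have "i \<cdot> (u \<cdot> p k) = i \<cdot> (v \<cdot> p k)"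
      using Comp_assoc[OF pk u i] Comp_assoc[OF pk v i] eq by simp
    then show "u \<cdot> p k = v \<cdot> p k"
      using connectedD(2)[OF _ S] X k Comp_in_Hom[OF pk] u v by blast
  qed
qed

text \<open>A test object \<open>T\<close> is decomposed, and \<open>u\<close> is lifted to
  \<open>A1\<close> component by component. The pullback on the other side follows by swapping the
  summands.\<close>

lemma pullback_of_decomposition:
  assumes dec: "\<And>T. T \<in> Ob C \<Longrightarrow> is_finite_coproduct_of_connected C T"
    and S: "is_binary_coproduct C X1 X2 S i1 i2" and A: "is_binary_coproduct C A1 A2 A a1 a2"
    and f: "f \<in> Hom C A S" and h1: "h1 \<in> Hom C A1 X1" and h2: "h2 \<in> Hom C A2 X2"
    and c1: "f \<cdot> a1 = i1 \<cdot> h1" and c2: "f \<cdot> a2 = i2 \<cdot> h2"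
  shows "is_pullback C f i1 A1 a1 h1"
proof (rule pullbackI[OF f _ _ h1 c1])
  note i1 = binary_coproductD(4)[OF S] and i2 = binary_coproductD(5)[OF S]
    and a1 = binary_coproductD(4)[OF A] and a2 = binary_coproductD(5)[OF A]
  show "i1 \<in> Hom C X1 S" "a1 \<in> Hom C A1 A" by (fact i1 a1)+
  fix T u v assume u: "u \<in> Hom C T A" and v: "v \<in> Hom C T X1" and eq: "f \<cdot> u = i1 \<cdot> v"
  have T: "T \<in> Ob C" using Hom_objects[OF u] by blast
  note decT = dec[OF T]
  obtain n X p where X: "\<And>k. k < (n::nat) \<Longrightarrow> connected_object C (X k)" and p: "is_coproduct C {..<n} X p T"
    using decT unfolding is_finite_coproduct_of_connected_def by blast
  have "\<exists>w. w \<in> Hom C (X k) A1 \<and> a1 \<cdot> w = u \<cdot> p k" if k: "k < n" for k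
  proof -
    have pk: "p k \<in> Hom C (X k) T" using coproductD(3)[OF p] k by blast
    \<comment> \<open>Landing in \<open>A2\<close> would make the same morphism into
      \<open>S\<close> come from both \<open>X1\<close> and \<open>X2\<close>, which is impossible
      for a connected source.\<close>
    have "\<nexists>w. w \<in> Hom C (X k) A2 \<and> a2 \<cdot> w = u \<cdot> p k"
    proof
      assume "\<exists>w. w \<in> Hom C (X k) A2 \<and> a2 \<cdot> w = u \<cdot> p k"
      then obtain w where w: "w \<in> Hom C (X k) A2" "a2 \<cdot> w = u \<cdot> p k" by blast
      have "i1 \<cdot> (v \<cdot> p k) = f \<cdot> (u \<cdot> p k)"
        using Comp_assoc[OF pk v i1] Comp_assoc[OF pk u f] eq by simp
      also have "\<dots> = (f \<cdot> a2) \<cdot> w" using Comp_assoc[OF w(1) a2 f] w(2) by simp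
      also have "\<dots> = i2 \<cdot> (h2 \<cdot> w)" using Comp_assoc[OF w(1) h2 i2] c2 by simp
      finally show False
        using connectedD(3)[OF X[OF k] S Comp_in_Hom[OF pk v] Comp_in_Hom[OF w(1) h2]] by blast
    qed
    then show ?thesis using connectedD(1)[OF X[OF k] A Comp_in_Hom[OF pk u]] by blast
  qed
  then obtain w where w: "\<And>k. k < n \<Longrightarrow> w k \<in> Hom C (X k) A1 \<and> a1 \<cdot> w k = u \<cdot> p k" by metis
  obtain h where h: "h \<in> Hom C T A1" "\<forall>k\<in>{..<n}. h \<cdot> p k = w k"
    using coproduct_desc[OF p binary_coproductD(1)[OF A], of w] w by blast
  have ah: "a1 \<cdot> h = u"
  proof (rule coproduct_ext[OF p Comp_in_Hom[OF h(1) a1] u])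
    fix k assume "k \<in> {..<n}"
    then show "(a1 \<cdot> h) \<cdot> p k = u \<cdot> p k"
      using Comp_assoc[OF coproductD(3)[OF p] h(1) a1] h(2) w by simp
  qed
  have "i1 \<cdot> (h1 \<cdot> h) = i1 \<cdot> v"
    using Comp_assoc[OF h(1) h1 i1] Comp_assoc[OF h(1) a1 f] c1 ah eq by simp
  then have "h1 \<cdot> h = v"
    using coprojection_monic_of_decomposition[OF decT S Comp_in_Hom[OF h(1) h1] v] by blast
  \<comment> \<open>Uniqueness: \<open>a1\<close> can be cancelled from
    \<open>a1 \<cdot> h = u\<close>, by the monicity just used for \<open>i1\<close>.\<close>
  with h(1) ah show "\<exists>!h. h \<in> Hom C T A1 \<and> a1 \<cdot> h = u \<and> h1 \<cdot> h = v"
    using coprojection_monic_of_decomposition[OF decT A] by (intro ex1I[of _ h]) auto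
qed

lemma coproduct_induced_splitting:
  assumes fc: "has_finite_coproducts C"
    and dec: "is_finite_coproduct_of_connected C A"
    and S: "is_binary_coproduct C X1 X2 S i1 i2" and f: "f \<in> Hom C A S"
  shows "\<exists>A1 A2 a1 a2 h1 h2. is_binary_coproduct C A1 A2 A a1 a2 \<and>
    h1 \<in> Hom C A1 X1 \<and> h2 \<in> Hom C A2 X2 \<and> f \<cdot> a1 = i1 \<cdot> h1 \<and> f \<cdot> a2 = i2 \<cdot> h2"
proof -
  obtain n X p where X: "\<And>k. k < (n::nat) \<Longrightarrow> connected_object C (X k)" and p: "is_coproduct C {..<n} X p A"
    using dec unfolding is_finite_coproduct_of_connected_def by blast
  note i1 = binary_coproductD(4)[OF S] and i2 = binary_coproductD(5)[OF S]
  \<comment> \<open>\<open>K\<close> collects the components that \<open>f\<close> sends into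
    \<open>X1\<close>; by connectedness the remaining ones go to \<open>X2\<close>. The summands
    \<open>A1\<close> and \<open>A2\<close> are the corresponding partial coproducts.\<close>
  define K where "K = {k. k < n \<and> (\<exists>g\<in>Hom C (X k) X1. i1 \<cdot> g = f \<cdot> p k)}"
  define L where "L = {..<n} - K"
  have KL: "{..<n} = K \<union> L" "K \<inter> L = {}" by (auto simp: K_def L_def)
  have fin: "finite K" "finite L" using KL(1) by (metis finite_Un finite_lessThan)+
  note p' = p[unfolded KL(1)]
  obtain q A1 where A1: "is_coproduct C K X q A1"
    using finite_coproduct_exists[OF fc fin(1)] coproductD(2)[OF p'] by blast
  obtain r A2 where A2: "is_coproduct C L X r A2"
    using finite_coproduct_exists[OF fc fin(2)] coproductD(2)[OF p'] by blast
  obtain a1 a2 where bc: "is_binary_coproduct C A1 A2 A a1 a2"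
    and a1: "\<forall>k\<in>K. a1 \<cdot> q k = p k" and a2: "\<forall>k\<in>L. a2 \<cdot> r k = p k"
    using coproduct_split[OF p' KL(2) A1 A2] by blast
  note a1H = binary_coproductD(4)[OF bc] and a2H = binary_coproductD(5)[OF bc]
  have "\<forall>k\<in>K. \<exists>g. g \<in> Hom C (X k) X1 \<and> i1 \<cdot> g = f \<cdot> p k" by (auto simp: K_def)
  then obtain g where g: "\<And>k. k \<in> K \<Longrightarrow> g k \<in> Hom C (X k) X1 \<and> i1 \<cdot> g k = f \<cdot> p k" by metis
  have "\<forall>k\<in>L. \<exists>g. g \<in> Hom C (X k) X2 \<and> i2 \<cdot> g = f \<cdot> p k"
    using connectedD(1)[OF X S Comp_in_Hom[OF coproductD(3)[OF p] f]] by (auto simp: L_def K_def)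
  then obtain g' where g': "\<And>k. k \<in> L \<Longrightarrow> g' k \<in> Hom C (X k) X2 \<and> i2 \<cdot> g' k = f \<cdot> p k" by metis
  obtain h1 where h1: "h1 \<in> Hom C A1 X1" "\<forall>k\<in>K. h1 \<cdot> q k = g k"
    using coproduct_desc[OF A1 binary_coproductD(1)[OF S], of g] g by blast
  obtain h2 where h2: "h2 \<in> Hom C A2 X2" "\<forall>k\<in>L. h2 \<cdot> r k = g' k"
    using coproduct_desc[OF A2 binary_coproductD(2)[OF S], of g'] g' by blast
  have "f \<cdot> a1 = i1 \<cdot> h1"
  proof (rule coproduct_ext[OF A1 Comp_in_Hom[OF a1H f] Comp_in_Hom[OF h1(1) i1]])
    fix k assume k: "k \<in> K"
    show "(f \<cdot> a1) \<cdot> q k = (i1 \<cdot> h1) \<cdot> q k"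
      using Comp_assoc[OF coproductD(3)[OF A1 k] a1H f] Comp_assoc[OF coproductD(3)[OF A1 k] h1(1) i1]
        a1 h1(2) g k by simp
  qed
  moreover have "f \<cdot> a2 = i2 \<cdot> h2"
  proof (rule coproduct_ext[OF A2 Comp_in_Hom[OF a2H f] Comp_in_Hom[OF h2(1) i2]])
    fix k assume k: "k \<in> L"
    show "(f \<cdot> a2) \<cdot> r k = (i2 \<cdot> h2) \<cdot> r k"
      using Comp_assoc[OF coproductD(3)[OF A2 k] a2H f] Comp_assoc[OF coproductD(3)[OF A2 k] h2(1) i2]
        a2 h2(2) g' k by simp
  qed
  ultimately show ?thesis using bc h1(1) h2(1) by blast
qed

theorem extensive_of_decompositions:
  assumes fc: "has_finite_coproducts C"
    and dec: "\<And>A. A \<in> Ob C \<Longrightarrow> is_finite_coproduct_of_connected C A"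
  shows "extensive C"
  unfolding extensive_def
proof (intro conjI fc allI impI iffI; elim conjE)
  fix X1 X2 S i1 i2 A f
  assume S: "is_binary_coproduct C X1 X2 S i1 i2" and A: "A \<in> Ob C" and f: "f \<in> Hom C A S"
  \<comment> \<open>The left summand of the splitting induced by \<open>f\<close> is the required
    pullback.\<close>
  from coproduct_induced_splitting[OF fc dec[OF A] S f] pullback_of_decomposition[OF dec S _ f]
  show "\<exists>P p q. is_pullback C f i1 P p q" by metis
next
  fix X1 X2 S i1 i2 A f A1 A2 a1 a2 h1 h2
  assume S: "is_binary_coproduct C X1 X2 S i1 i2" and A: "A \<in> Ob C" and f: "f \<in> Hom C A S"
    and h: "h1 \<in> Hom C A1 X1" "h2 \<in> Hom C A2 X2" and c: "f \<cdot> a1 = i1 \<cdot> h1" "f \<cdot> a2 = i2 \<cdot> h2"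
  show "is_pullback C f i1 A1 a1 h1" if "is_binary_coproduct C A1 A2 A a1 a2"
    using pullback_of_decomposition[OF dec S that f h c] .
  show "is_pullback C f i2 A2 a2 h2" if "is_binary_coproduct C A1 A2 A a1 a2"
    using pullback_of_decomposition[OF dec binary_coproduct_sym[OF S] binary_coproduct_sym[OF that] f
        h(2,1) c(2,1)] .
  assume P: "is_pullback C f i1 A1 a1 h1" "is_pullback C f i2 A2 a2 h2"
  \<comment> \<open>For the converse, the given pullbacks are compared with those of the induced
    splitting, whose top row is known to be a coproduct.\<close>
  obtain B1 B2 b1 b2 g1 g2 where B: "is_binary_coproduct C B1 B2 A b1 b2"
    and g: "g1 \<in> Hom C B1 X1" "g2 \<in> Hom C B2 X2" and d: "f \<cdot> b1 = i1 \<cdot> g1" "f \<cdot> b2 = i2 \<cdot> g2"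
    using coproduct_induced_splitting[OF fc dec[OF A] S f] by metis
  have Q1: "is_pullback C f i1 B1 b1 g1"
    using pullback_of_decomposition[OF dec S B f g d] .
  have Q2: "is_pullback C f i2 B2 b2 g2"
    using pullback_of_decomposition[OF dec binary_coproduct_sym[OF S] binary_coproduct_sym[OF B] f
        g(2,1) d(2,1)] .
  obtain u u' where u: "u \<in> Hom C A1 B1" "u' \<in> Hom C B1 A1" "u \<cdot> u' = Id C B1" "u' \<cdot> u = Id C A1"
    "b1 \<cdot> u = a1"
    using pullback_unique[OF P(1) Q1 f binary_coproductD(4)[OF S]] by blast
  obtain v v' where v: "v \<in> Hom C A2 B2" "v' \<in> Hom C B2 A2" "v \<cdot> v' = Id C B2" "v' \<cdot> v = Id C A2"
    "b2 \<cdot> v = a2"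
    using pullback_unique[OF P(2) Q2 f binary_coproductD(5)[OF S]] by blast
  show "is_binary_coproduct C A1 A2 A a1 a2"
    using binary_coproduct_iso[OF B u(1-4) v(1-4)] u(5) v(5) by simp
qed


section \<open>Extensive categories\<close>

lemma extensive_has_finite_coproducts: "extensive C \<Longrightarrow> has_finite_coproducts C"
  by (simp add: extensive_def)

lemma extensive_pullback_exists:
  assumes "extensive C" and "is_binary_coproduct C X1 X2 S i1 i2" and "f \<in> Hom C A S"
  shows "\<exists>P p q. is_pullback C f i1 P p q"
  using assms Hom_objects(1)[OF assms(3)] unfolding extensive_def by blast

lemma extensive_iff:
  assumes ext: "extensive C" and S: "is_binary_coproduct C X1 X2 S i1 i2" and f: "f \<in> Hom C A S"
    and a1: "a1 \<in> Hom C A1 A" and a2: "a2 \<in> Hom C A2 A"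
    and h: "h1 \<in> Hom C A1 X1" "h2 \<in> Hom C A2 X2" "f \<cdot> a1 = i1 \<cdot> h1" "f \<cdot> a2 = i2 \<cdot> h2"
  shows "is_binary_coproduct C A1 A2 A a1 a2 \<longleftrightarrow>
    is_pullback C f i1 A1 a1 h1 \<and> is_pullback C f i2 A2 a2 h2"
proof -
  have "A \<in> Ob C" "A1 \<in> Ob C" "A2 \<in> Ob C" using Hom_objects a1 a2 by blast+
  with ext[unfolded extensive_def, THEN conjunct2, THEN conjunct2, rule_format,
      of X1 X2 S i1 i2 A A1 A2 f a1 a2 h1 h2] assms
  show ?thesis by blast
qed

text \<open>Extensivity is applied to \<open>i1\<close> itself with X1 = X1 + 0 as the top row. The
  left square is the kernel pair of \<open>i1\<close>, the right one the intersection of the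
  coprojections.\<close>

lemma extensive_coprojections:
  assumes ext: "extensive C" and S: "is_binary_coproduct C X1 X2 S i1 i2" and Z: "initial_object Z"
    and z1: "z1 \<in> Hom C Z X1" and z2: "z2 \<in> Hom C Z X2"
  shows "is_pullback C i1 i1 X1 (Id C X1) (Id C X1) \<and> is_pullback C i1 i2 Z z1 z2"
proof -
  note i1 = binary_coproductD(4)[OF S] and i2 = binary_coproductD(5)[OF S]
    and X1 = binary_coproductD(1)[OF S]
  have "i1 \<cdot> z1 = i2 \<cdot> z2"
    using Z Comp_in_Hom[OF z1 i1] Comp_in_Hom[OF z2 i2] binary_coproductD(3)[OF S]
    unfolding initial_object_def by blast
  from extensive_iff[OF ext S i1 Id_in_Hom[OF X1] z1 Id_in_Hom[OF X1] z2 _ this]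
  show ?thesis using binary_coproduct_initial[OF X1 Z z1] by simp
qed

lemma extensive_coprojection_monic:
  assumes ext: "extensive C" and S: "is_binary_coproduct C X1 X2 S i1 i2"
    and u: "u \<in> Hom C T X1" and v: "v \<in> Hom C T X1" and eq: "i1 \<cdot> u = i1 \<cdot> v"
  shows "u = v"
proof -
  note i1 = binary_coproductD(4)[OF S]
  obtain Z where Z: "initial_object Z"
    using initial_object_exists[OF extensive_has_finite_coproducts[OF ext]] by blast
  then obtain z1 z2 where "z1 \<in> Hom C Z X1" "z2 \<in> Hom C Z X2"
    using binary_coproductD(1,2)[OF S] unfolding initial_object_def by blast
  then have "is_pullback C i1 i1 X1 (Id C X1) (Id C X1)"
    using extensive_coprojections[OF ext S Z] by blast
  \<comment> \<open>The mediating morphism composed with the identity is \<open>u\<close> on one leg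
    and \<open>v\<close> on the other.\<close>
  from pullbackD(4)[OF this i1 i1 u v eq] show ?thesis
    using Id_Comp by metis
qed

text \<open>The object \<open>0\<close> is the coproduct \<open>0 + 0\<close> with identities as coprojections; pulling these back
  along \<open>A \<rightarrow> 0\<close> makes \<open>A\<close> the coproduct \<open>A + A\<close> with identities as coprojections.\<close>

lemma extensive_initial_strict:
  assumes ext: "extensive C" and Z: "initial_object Z" and f: "f \<in> Hom C A Z"
  shows "initial_object A"
proof -
  have A: "A \<in> Ob C" and ZO: "Z \<in> Ob C" using Hom_objects[OF f] by blast+
  note IA = Id_in_Hom[OF A] and IZ = Id_in_Hom[OF ZO]
  have S: "is_binary_coproduct C Z Z Z (Id C Z) (Id C Z)"
    using binary_coproduct_initial[OF ZO Z IZ] .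
  have c: "f \<cdot> Id C A = Id C Z \<cdot> f" using Comp_Id[OF f] Id_Comp[OF f] by simp
  \<comment> \<open>Pulling back an identity yields an identity, so both squares over Z = Z + Z are
    this one.\<close>
  have P: "is_pullback C f (Id C Z) A (Id C A) f"
  proof (rule pullbackI[OF f IZ IA f c])
    fix T u v assume u: "u \<in> Hom C T A" and v: "v \<in> Hom C T Z" and "f \<cdot> u = Id C Z \<cdot> v"
    then have "f \<cdot> u = v" using Id_Comp[OF v] by simp
    with u show "\<exists>!h. h \<in> Hom C T A \<and> Id C A \<cdot> h = u \<and> f \<cdot> h = v"
      by (metis Id_Comp)
  qed
  have AA: "is_binary_coproduct C A A A (Id C A) (Id C A)"
    using extensive_iff[OF ext S f IA IA f f c c] P by simp
  \<comment> \<open>The morphism induced by \<open>g\<close> and \<open>h\<close> on A + A restricts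
    along the identity to both of them.\<close>
  have uniq: "g = h" if "g \<in> Hom C A T" "h \<in> Hom C A T" for g h T
    using binary_coproduct_desc[OF AA that] by force
  have "\<exists>h. h \<in> Hom C A T" if "T \<in> Ob C" for T
    using Z that Comp_in_Hom[OF f] unfolding initial_object_def by blast
  with A uniq show ?thesis unfolding initial_object_def by blast
qed

lemma extensive_coprojections_disjoint:
  assumes ext: "extensive C" and S: "is_binary_coproduct C X1 X2 S i1 i2"
    and u: "u \<in> Hom C T X1" and v: "v \<in> Hom C T X2" and eq: "i1 \<cdot> u = i2 \<cdot> v"
  shows "initial_object T"
proof -
  obtain Z where Z: "initial_object Z"
    using initial_object_exists[OF extensive_has_finite_coproducts[OF ext]] by blast
  then obtain z1 z2 where "z1 \<in> Hom C Z X1" "z2 \<in> Hom C Z X2"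
    using binary_coproductD(1,2)[OF S] unfolding initial_object_def by blast
  then have "is_pullback C i1 i2 Z z1 z2"
    using extensive_coprojections[OF ext S Z] by blast
  \<comment> \<open>The pullback supplies a morphism from \<open>T\<close> to \<open>Z\<close>, and
    the initial object is strict.\<close>
  from pullbackD(4)[OF this binary_coproductD(4,5)[OF S] u v eq] show ?thesis
    using extensive_initial_strict[OF ext Z] by blast
qed

text \<open>\<open>f\<close> is pulled back along both coprojections, along the second one by
  symmetry; extensivity makes the two pullbacks a coproduct diagram.\<close>

lemma extensive_splitting:
  assumes ext: "extensive C" and S: "is_binary_coproduct C X1 X2 S i1 i2" and f: "f \<in> Hom C A S"
  shows "\<exists>A1 A2 a1 a2 h1 h2. is_binary_coproduct C A1 A2 A a1 a2 \<and>
    h1 \<in> Hom C A1 X1 \<and> h2 \<in> Hom C A2 X2 \<and> f \<cdot> a1 = i1 \<cdot> h1 \<and> f \<cdot> a2 = i2 \<cdot> h2"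
proof -
  obtain A1 a1 h1 where P1: "is_pullback C f i1 A1 a1 h1"
    using extensive_pullback_exists[OF ext S f] by blast
  obtain A2 a2 h2 where P2: "is_pullback C f i2 A2 a2 h2"
    using extensive_pullback_exists[OF ext binary_coproduct_sym[OF S] f] by blast
  note D1 = pullbackD[OF P1 f binary_coproductD(4)[OF S]]
    and D2 = pullbackD[OF P2 f binary_coproductD(5)[OF S]]
  have "is_binary_coproduct C A1 A2 A a1 a2"
    using extensive_iff[OF ext S f D1(1) D2(1) D1(2) D2(2) D1(3) D2(3)] P1 P2 by blast
  with D1 D2 show ?thesis by blast
qed

text \<open>The section is induced by the identity on \<open>A1\<close> and the unique morphism out
  of \<open>A2\<close>. It lets a factorization known on \<open>A1\<close> be extended to
  \<open>A\<close>.\<close>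

lemma coprojection_section:
  assumes A: "is_binary_coproduct C A1 A2 A a1 a2" and A2: "initial_object A2"
  shows "\<exists>s\<in>Hom C A A1. a1 \<cdot> s = Id C A"
proof -
  note a1 = binary_coproductD(4)[OF A] and a2 = binary_coproductD(5)[OF A]
    and AO = binary_coproductD(3)[OF A]
  obtain z where z: "z \<in> Hom C A2 A1"
    using A2 binary_coproductD(1)[OF A] unfolding initial_object_def by blast
  obtain s where s: "s \<in> Hom C A A1" "s \<cdot> a1 = Id C A1" "s \<cdot> a2 = z"
    using binary_coproduct_desc[OF A Id_in_Hom[OF binary_coproductD(1)[OF A]] z] by blast
  have "a1 \<cdot> s = Id C A"
  proof (rule binary_coproduct_ext[OF A Comp_in_Hom[OF s(1) a1] Id_in_Hom[OF AO]])
    show "(a1 \<cdot> s) \<cdot> a1 = Id C A \<cdot> a1"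
      using Comp_assoc[OF a1 s(1) a1] s(2) Comp_Id[OF a1] Id_Comp[OF a1] by simp
    show "(a1 \<cdot> s) \<cdot> a2 = Id C A \<cdot> a2"
      using A2 AO Comp_in_Hom[OF a2 Comp_in_Hom[OF s(1) a1]] Comp_in_Hom[OF a2 Id_in_Hom[OF AO]]
      unfolding initial_object_def by blast
  qed
  with s(1) show ?thesis by blast
qed

text \<open>A morphism from \<open>Z\<close> to a coproduct splits \<open>Z\<close>; one part is
  initial, so the morphism factors through a single coprojection. Injectivity comes from monic and
  disjoint coprojections.\<close>

lemma extensive_indecomposable_connected:
  assumes ext: "extensive C" and Z: "Z \<in> Ob C" and ni: "\<not> initial_object Z"
    and indec: "\<And>A B i j. is_binary_coproduct C A B Z i j \<Longrightarrow> initial_object A \<or> initial_object B"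
  shows "connected_object C Z"
  unfolding connected_object_def
proof (intro conjI Z allI impI)
  fix A B S i j assume S: "is_binary_coproduct C A B S i j"
  note i = binary_coproductD(4)[OF S] and j = binary_coproductD(5)[OF S]
  let ?F = "case_sum (\<lambda>f. i \<cdot> f) (\<lambda>g. j \<cdot> g)"
  \<comment> \<open>The coproduct diagram is generalized here so that the same argument serves with
    the summands interchanged.\<close>
  have left: "\<exists>g\<in>Hom C Z A. i \<cdot> g = f"
    if S: "is_binary_coproduct C A B S i j" and f: "f \<in> Hom C Z S"
      and Z': "is_binary_coproduct C Z1 Z2 Z a1 a2" and Z2: "initial_object Z2"
      and h: "h \<in> Hom C Z1 A" "f \<cdot> a1 = i \<cdot> h" for A B S i j f Z1 Z2 a1 a2 h
  proof -
    obtain s where s: "s \<in> Hom C Z Z1" "a1 \<cdot> s = Id C Z"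
      using coprojection_section[OF Z' Z2] by blast
    have "i \<cdot> (h \<cdot> s) = f"
      using Comp_assoc[OF s(1) h(1) binary_coproductD(4)[OF S]]
        Comp_assoc[OF s(1) binary_coproductD(4)[OF Z'] f] s(2) h(2) Comp_Id[OF f] by simp
    with Comp_in_Hom[OF s(1) h(1)] show ?thesis by blast
  qed
  have factor: "(\<exists>g\<in>Hom C Z A. i \<cdot> g = f) \<or> (\<exists>g\<in>Hom C Z B. j \<cdot> g = f)" if f: "f \<in> Hom C Z S" for f
  proof -
    obtain Z1 Z2 a1 a2 h1 h2 where Z': "is_binary_coproduct C Z1 Z2 Z a1 a2"
      and h: "h1 \<in> Hom C Z1 A" "h2 \<in> Hom C Z2 B" "f \<cdot> a1 = i \<cdot> h1" "f \<cdot> a2 = j \<cdot> h2"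
      using extensive_splitting[OF ext S f] by metis
    from indec[OF Z'] show ?thesis
    proof
      assume "initial_object Z1"
      from left[OF binary_coproduct_sym[OF S] f binary_coproduct_sym[OF Z'] this h(2,4)]
      show ?thesis by blast
    next
      assume "initial_object Z2"
      from left[OF S f Z' this h(1,3)] show ?thesis by blast
    qed
  qed
  show "bij_betw ?F (Hom C Z A <+> Hom C Z B) (Hom C Z S)"
    unfolding bij_betw_def
  proof
    \<comment> \<open>A common value coming from different summands would make \<open>Z\<close>
      initial, contrary to \<open>ni\<close>.\<close>
    show "inj_on ?F (Hom C Z A <+> Hom C Z B)"
      using extensive_coprojection_monic[OF ext S] extensive_coprojection_monic[OF ext binary_coproduct_sym[OF S]]
        extensive_coprojections_disjoint[OF ext S] ni
      by (auto simp: inj_on_def)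
    show "?F ` (Hom C Z A <+> Hom C Z B) = Hom C Z S"
    proof
      show "?F ` (Hom C Z A <+> Hom C Z B) \<subseteq> Hom C Z S"
        using Comp_in_Hom i j by auto
      show "Hom C Z S \<subseteq> ?F ` (Hom C Z A <+> Hom C Z B)"
      proof
        fix f assume "f \<in> Hom C Z S"
        from factor[OF this] show "f \<in> ?F ` (Hom C Z A <+> Hom C Z B)"
          by (force simp: image_iff)
      qed
    qed
  qed
qed

section \<open>Existence of decompositions by repeated splitting\<close>

lemma decomposition_initial:
  assumes "initial_object A"
  shows "is_finite_coproduct_of_connected C A"
  unfolding is_finite_coproduct_of_connected_def
  using assms by (intro exI[of _ 0]) (simp add: coproduct_empty_iff)

lemma decomposition_connected:
  assumes "connected_object C A"
  shows "is_finite_coproduct_of_connected C A"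
  unfolding is_finite_coproduct_of_connected_def
  using assms coproduct_singleton[of "\<lambda>_. A" "0::nat"] connected_Ob[OF assms]
  by (intro exI[of _ "1::nat"] exI[of _ "\<lambda>_. A"] exI[of _ "\<lambda>_. Id C A"]) (simp add: lessThan_Suc)

lemma decomposition_binary_coproduct:
  assumes S: "is_binary_coproduct C A B S i j"
    and A: "is_finite_coproduct_of_connected C A" and B: "is_finite_coproduct_of_connected C B"
  shows "is_finite_coproduct_of_connected C S"
proof -
  obtain n X p where X: "\<forall>k<(n::nat). connected_object C (X k)" and p: "is_coproduct C {..<n} X p A"
    using A unfolding is_finite_coproduct_of_connected_def by blast
  obtain m Y q where Y: "\<forall>k<(m::nat). connected_object C (Y k)" and q: "is_coproduct C {..<m} Y q B"
    using B unfolding is_finite_coproduct_of_connected_def by blast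
  \<comment> \<open>The two families are concatenated, the second one shifted by
    \<open>n\<close>.\<close>
  define W where "W k = (if k < n then X k else Y (k - n))" for k
  have "bij_betw (\<lambda>k. k - n) {n..<n + m} {..<m}"
    by (rule bij_betw_byWitness[where f' = "\<lambda>k. k + n"]) auto
  from coproduct_reindex[OF this q]
  have q': "is_coproduct C {n..<n + m} W (q \<circ> (\<lambda>k. k - n)) B"
    by (subst coproduct_cong[where Y = "Y \<circ> (\<lambda>k. k - n)"]) (auto simp: W_def)
  have p': "is_coproduct C {..<n} W p A"
    using p by (subst coproduct_cong[where Y = X]) (auto simp: W_def)
  have "{..<n} \<union> {n..<n + m} = {..<n + m}" "{..<n} \<inter> {n..<n + m} = {}" by auto
  with coproduct_join[OF p' q' _ S] obtain r where "is_coproduct C {..<n + m} W r S" by auto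
  moreover have "\<forall>k<n + m. connected_object C (W k)" using X Y by (auto simp: W_def)
  ultimately show ?thesis unfolding is_finite_coproduct_of_connected_def by blast
qed

text \<open>The universal property is a bijection between morphisms out of \<open>S\<close> and
  pairs of morphisms.\<close>

lemma card_Hom_binary_coproduct:
  assumes S: "is_binary_coproduct C A B S i j"
  shows "card (Hom C S Q) = card (Hom C A Q) * card (Hom C B Q)"
proof -
  have "bij_betw (\<lambda>h. (h \<cdot> i, h \<cdot> j)) (Hom C S Q) (Hom C A Q \<times> Hom C B Q)"
    unfolding bij_betw_def
  proof
    show "inj_on (\<lambda>h. (h \<cdot> i, h \<cdot> j)) (Hom C S Q)"
      using binary_coproduct_ext[OF S] by (auto simp: inj_on_def)
    show "(\<lambda>h. (h \<cdot> i, h \<cdot> j)) ` Hom C S Q = Hom C A Q \<times> Hom C B Q"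
    proof
      show "(\<lambda>h. (h \<cdot> i, h \<cdot> j)) ` Hom C S Q \<subseteq> Hom C A Q \<times> Hom C B Q"
        using Comp_in_Hom binary_coproductD(4,5)[OF S] by auto
      show "Hom C A Q \<times> Hom C B Q \<subseteq> (\<lambda>h. (h \<cdot> i, h \<cdot> j)) ` Hom C S Q"
        using binary_coproduct_desc[OF S] by (fastforce simp: image_iff)
    qed
  qed
  from bij_betw_same_card[OF this] show ?thesis by (simp add: card_cartesian_product)
qed

text \<open>The target \<open>Q\<close> stays fixed during the induction so that the cardinalities
  are comparable. The morphism \<open>b\<close> restricts to every summand and yields two morphisms
  to \<open>Q\<close> there.\<close>

lemma locally_finite_extensive_decomposition_aux:
  assumes lf: "locally_finite C" and ext: "extensive C"
    and Q: "is_binary_coproduct C B B Q s t" and "b \<in> Hom C A B"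
  shows "is_finite_coproduct_of_connected C A"
  using assms(4)
proof (induction "card (Hom C A Q)" arbitrary: A b rule: less_induct)
  case less
  have A: "A \<in> Ob C" using Hom_objects[OF less.prems] by blast
  show ?case
  proof (cases "initial_object A \<or> connected_object C A")
    case True
    then show ?thesis using decomposition_initial decomposition_connected by blast
  next
    case False
    with extensive_indecomposable_connected[OF ext A] obtain A1 A2 i j
      where bc: "is_binary_coproduct C A1 A2 A i j"
        and ni: "\<not> initial_object A1" "\<not> initial_object A2" by blast
    have two: "card (Hom C A' Q) \<ge> 2" if u: "u \<in> Hom C A' B" and "\<not> initial_object A'" for A' u
    proof -
      have "finite (Hom C A' Q)"
        using lf Hom_objects[OF u] binary_coproductD(3)[OF Q] unfolding locally_finite_def by blast
      moreover have "s \<cdot> u \<in> Hom C A' Q" "t \<cdot> u \<in> Hom C A' Q"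
        using Comp_in_Hom[OF u] binary_coproductD(4,5)[OF Q] by blast+
      \<comment> \<open>Equality would make \<open>A'\<close> initial by disjointness of the
        coprojections.\<close>
      moreover have "s \<cdot> u \<noteq> t \<cdot> u"
        using extensive_coprojections_disjoint[OF ext Q u u] that by blast
      ultimately show ?thesis
        using card_mono[of "Hom C A' Q" "{s \<cdot> u, t \<cdot> u}"] by simp
    qed
    note u1 = Comp_in_Hom[OF binary_coproductD(4)[OF bc] less.prems]
      and u2 = Comp_in_Hom[OF binary_coproductD(5)[OF bc] less.prems]
    \<comment> \<open>A product of two factors that are both at least 2 exceeds each of
      them.\<close>
    have "card (Hom C A1 Q) < card (Hom C A Q)" "card (Hom C A2 Q) < card (Hom C A Q)"
      using card_Hom_binary_coproduct[OF bc, of Q] two[OF u1 ni(1)] two[OF u2 ni(2)] by simp_all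
    with less.hyps u1 u2 show ?thesis
      using decomposition_binary_coproduct[OF bc] by blast
  qed
qed

theorem locally_finite_extensive_decomposition:
  assumes lf: "locally_finite C" and ext: "extensive C" and A: "A \<in> Ob C"
  shows "is_finite_coproduct_of_connected C A"
proof -
  obtain Q s t where "is_binary_coproduct C A A Q s t"
    using binary_coproduct_exists[OF extensive_has_finite_coproducts[OF ext] A A] by blast
  \<comment> \<open>The induction starts with \<open>B = A\<close> and the identity of
    \<open>A\<close> as \<open>b\<close>.\<close>
  from locally_finite_extensive_decomposition_aux[OF lf ext this Id_in_Hom[OF A]] show ?thesis .
qed

end

theorem theorem1p10:
  shows
  "(\<forall>C :: ('o, 'm) category.
      category C \<and> locally_finite C \<and> extensive C \<longrightarrow>
      (\<forall>A\<in>Ob C. is_finite_coproduct_of_connected C A))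
   \<and>
   (\<forall>C :: ('o, 'm) category.
      category C \<and> has_finite_coproducts C \<and>
      (\<forall>A\<in>Ob C. is_finite_coproduct_of_connected C A) \<longrightarrow>
      extensive C)
   \<and>
   (\<forall>C :: ('o, 'm) category.
      category C \<and> extensive C \<longrightarrow>
      (\<forall>D\<in>Ob C. \<forall>(s::nat) (t::nat) X p S Y q T.
         (\<forall>i<s. connected_object C (X i)) \<and> is_coproduct C {..<s} X p S \<and> isomorphic C D S \<and>
         (\<forall>i<t. connected_object C (Y i)) \<and> is_coproduct C {..<t} Y q T \<and> isomorphic C D T \<longrightarrow>
         s = t \<and>
         (\<exists>\<pi>. bij_betw \<pi> {..<s} {..<s} \<and> (\<forall>i<s. isomorphic C (X i) (Y (\<pi> i))))))"
proof (intro conjI allI impI ballI; elim conjE)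
  fix C :: "('o, 'm) category" and A
  assume "category C" "locally_finite C" "extensive C" "A \<in> Ob C"
  then show "is_finite_coproduct_of_connected C A"
    by (rule category.locally_finite_extensive_decomposition)
next
  fix C :: "('o, 'm) category"
  assume "category C" "has_finite_coproducts C" "\<forall>A\<in>Ob C. is_finite_coproduct_of_connected C A"
  then show "extensive C" by (blast intro: category.extensive_of_decompositions)
next
  fix C :: "('o, 'm) category" and D and s t :: nat and X p S Y q T
  assume C: "category C" and ext: "extensive C"
    and X: "\<forall>i<s. connected_object C (X i)" "is_coproduct C {..<s} X p S" "isomorphic C D S"
    and Y: "\<forall>i<t. connected_object C (Y i)" "is_coproduct C {..<t} Y q T" "isomorphic C D T"
  interpret category C by (fact C)
  have "has_finite_coproducts C" using extensive_has_finite_coproducts[OF ext] .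
  moreover have "isomorphic C S T" using isomorphic_trans[OF isomorphic_sym[OF X(3)] Y(3)] .
  ultimately obtain \<pi> where \<pi>: "bij_betw \<pi> {..<s} {..<t}" "\<forall>i\<in>{..<s}. isomorphic C (X i) (Y (\<pi> i))"
    using connected_decomposition_unique[of "{..<s}" X p S "{..<t}" Y q T] X Y by auto
  \<comment> \<open>Equality of the lengths turns \<open>\<pi>\<close> into a permutation of one
    index set.\<close>
  from bij_betw_same_card[OF \<pi>(1)] have "s = t" by simp
  with \<pi> show "s = t" "\<exists>\<pi>. bij_betw \<pi> {..<s} {..<s} \<and> (\<forall>i<s. isomorphic C (X i) (Y (\<pi> i)))" by auto
qed

end
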